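(* Let $L$ be a free $\mathbb{Z}$-module of finite rank $n$, and let $A\subset L$ and $B\subset L$ be two primitive sublattices, i.e. subgroups such that $\mathrm{Tors}(L/A)=\mathrm{Tors}(L/B)=0$. Put $V=L\otimes_{\mathbb{Z}}\mathbb{C}$, and let $V_A=A\otimes_{\mathbb{Z}}\mathbb{C}$ and $V_B=B\otimes_{\mathbb{Z}}\mathbb{C}$, regarded as complex vector subspaces of $V$. Let $\exp_L:V\to T=L\otimes_{\mathbb{Z}}\mathbb{C}^*$ be the exponential map. If $V_A\cap V_B=0$, then there is a group isomorphism $$\mathrm{Tors}(L/(A+B))\;\to\;\exp_L(V_A)\cap\exp_L(V_B).$$
   Context: For an abelian group $G$, $\mathrm{Tors}(G)$ denotes its torsion subgroup. The exponential map is $\exp_L=1_L\otimes_{\mathbb{Z}}\exp : L\otimes_{\mathbb{Z}}\mathbb{C}\to L\otimes_{\mathbb{Z}}\mathbb{C}^*$, where $1_L:L\to L$ is the identity and $\exp:\mathbb{C}\to\mathbb{C}^*$ is $t\mapsto \exp(2\pi i t)$. It is a surjective group homomorphism with kernel $L=L\otimes_{\mathbb{Z}}\mathbb{Z}\subset V$. After choosing a $\mathbb{Z}$-basis of $L$, one has $L=\mathbb{Z}^n$, $V=\mathbb{C}^n$, $T=(\mathbb{C}^* )^n$ and $\exp_L(t_1,\dots,t_n)=(\exp(2\pi i t_1),\dots,\exp(2\pi i t_n))$. *)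

theory Defs
  imports Complex_Main "HOL-Algebra.Free_Abelian_Groups"
begin

text \<open>
  Abelian groups are commutative groups in the sense of HOL-Algebra, hence written
  multiplicatively; e.g. \<open>A <#>\<^bsub>L\<^esub> B\<close> is the subgroup \<open>A + B\<close> of \<open>L\<close>.
\<close>

definition torsion_subgroup :: "('a, 'm) monoid_scheme \<Rightarrow> 'a set" where
  "torsion_subgroup G = {x \<in> carrier G. \<exists>k::nat. k > 0 \<and> x [^]\<^bsub>G\<^esub> k = \<one>\<^bsub>G\<^esub>}"

definition primitive_sublattice :: "'a set \<Rightarrow> ('a, 'm) monoid_scheme \<Rightarrow> bool" where
  "primitive_sublattice A L \<longleftrightarrow>
     subgroup A L \<and> torsion_subgroup (L Mod A) = {\<one>\<^bsub>L Mod A\<^esub>}"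

definition complex_add_group :: "complex monoid" where
  "complex_add_group = \<lparr>carrier = UNIV, monoid.mult = (+), one = 0\<rparr>"

definition complex_mult_group :: "complex monoid" where
  "complex_mult_group = \<lparr>carrier = - {0}, monoid.mult = (*), one = 1\<rparr>"


section \<open>Tensor product of abelian groups over the integers\<close>

text \<open>
  The tensor product of \<open>G\<close> and \<open>H\<close> is the free abelian group on the pairs
  \<open>(x, y)\<close> modulo the subgroup generated by the biadditivity relations.
\<close>

definition tensor_relators ::
    "('a, 'm) monoid_scheme \<Rightarrow> ('b, 'n) monoid_scheme \<Rightarrow> ('a \<times> 'b \<Rightarrow>\<^sub>0 int) set" where
  "tensor_relators G H =
     {frag_of (x \<otimes>\<^bsub>G\<^esub> x', y) - frag_of (x, y) - frag_of (x', y) | x x' y.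
        x \<in> carrier G \<and> x' \<in> carrier G \<and> y \<in> carrier H} \<union>
     {frag_of (x, y \<otimes>\<^bsub>H\<^esub> y') - frag_of (x, y) - frag_of (x, y') | x y y'.
        x \<in> carrier G \<and> y \<in> carrier H \<and> y' \<in> carrier H}"

definition tensor_kernel ::
    "('a, 'm) monoid_scheme \<Rightarrow> ('b, 'n) monoid_scheme \<Rightarrow> ('a \<times> 'b \<Rightarrow>\<^sub>0 int) set" where
  "tensor_kernel G H =
     generate (free_Abelian_group (carrier G \<times> carrier H)) (tensor_relators G H)"

definition tensor_group ::
    "('a, 'm) monoid_scheme \<Rightarrow> ('b, 'n) monoid_scheme \<Rightarrow> ('a \<times> 'b \<Rightarrow>\<^sub>0 int) set monoid" where
  "tensor_group G H =
     free_Abelian_group (carrier G \<times> carrier H) Mod tensor_kernel G H"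

definition pure_tensor ::
    "('a, 'm) monoid_scheme \<Rightarrow> ('b, 'n) monoid_scheme \<Rightarrow> 'a \<Rightarrow> 'b \<Rightarrow> ('a \<times> 'b \<Rightarrow>\<^sub>0 int) set" where
  "pure_tensor G H x y =
     tensor_kernel G H #>\<^bsub>free_Abelian_group (carrier G \<times> carrier H)\<^esub> frag_of (x, y)"

text \<open>
  \<open>tensor_map G' H' f g\<close> is \<open>f \<otimes> g\<close>, with \<open>G'\<close> and \<open>H'\<close> the codomains of \<open>f\<close> and \<open>g\<close>.
  The image of a coset under the linear extension of \<open>(x, y) \<mapsto> (f x, g y)\<close> lies in
  a single coset, to which it is saturated; see \<open>tensor_map_hom\<close> and
  \<open>tensor_map_pure_tensor\<close> below.
\<close>

definition tensor_map ::
    "('c, 'm) monoid_scheme \<Rightarrow> ('d, 'n) monoid_scheme \<Rightarrow> ('a \<Rightarrow> 'c) \<Rightarrow> ('b \<Rightarrow> 'd) \<Rightarrow>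
     ('a \<times> 'b \<Rightarrow>\<^sub>0 int) set \<Rightarrow> ('c \<times> 'd \<Rightarrow>\<^sub>0 int) set" where
  "tensor_map G' H' f g X =
     tensor_kernel G' H' <#>\<^bsub>free_Abelian_group (carrier G' \<times> carrier H')\<^esub>
       (frag_extend (\<lambda>(x, y). frag_of (f x, g y)) ` X)"

lemma tensor_relators_subset:
  fixes G :: "('a, 'm) monoid_scheme" and H :: "('b, 'n) monoid_scheme"
  assumes "group G" "group H"
  shows "tensor_relators G H \<subseteq> carrier (free_Abelian_group (carrier G \<times> carrier H))"
proof -
  interpret G: group G by fact
  interpret H: group H by fact
  have diff: "Poly_Mapping.keys (frag_of a - frag_of b - frag_of c) \<subseteq> S"
    if "a \<in> S" "b \<in> S" "c \<in> S" for S and a b c :: "'a \<times> 'b"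
    using that keys_diff[of "frag_of a - frag_of b" "frag_of c"]
      keys_diff[of "frag_of a" "frag_of b"] by (auto simp: keys_frag_of)
  have "Poly_Mapping.keys r \<subseteq> carrier G \<times> carrier H" if "r \<in> tensor_relators G H" for r
    using that unfolding tensor_relators_def
    by (elim UnE CollectE exE conjE) (simp_all add: diff)
  then show ?thesis by auto
qed

lemma tensor_kernel_normal:
  assumes "group G" "group H"
  shows "tensor_kernel G H \<lhd> free_Abelian_group (carrier G \<times> carrier H)"
proof -
  interpret F: comm_group "free_Abelian_group (carrier G \<times> carrier H)"
    by (rule abelian_free_Abelian_group)
  show ?thesis
    unfolding tensor_kernel_def
    by (intro F.normal_iff_subgroup[THEN iffD2] F.generate_is_subgroup
        tensor_relators_subset assms)
qed

lemma comm_group_tensor_group: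
  assumes "group G" "group H"
  shows "comm_group (tensor_group G H)"
proof -
  interpret F: comm_group "free_Abelian_group (carrier G \<times> carrier H)"
    by (rule abelian_free_Abelian_group)
  show ?thesis
    unfolding tensor_group_def
    by (intro F.abelian_FactGroup normal_imp_subgroup tensor_kernel_normal assms)
qed

lemma frag_extend_hom:
  assumes "f \<in> hom G G'" "g \<in> hom H H'"
  shows "frag_extend (\<lambda>(x, y). frag_of (f x, g y))
           \<in> hom (free_Abelian_group (carrier G \<times> carrier H))
                 (free_Abelian_group (carrier G' \<times> carrier H'))"
proof (rule homI)
  fix c assume c: "c \<in> carrier (free_Abelian_group (carrier G \<times> carrier H))"
  let ?\<phi> = "\<lambda>(x, y). frag_of (f x, g y)"
  have "Poly_Mapping.keys (frag_extend ?\<phi> c) \<subseteq>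
      (\<Union>p \<in> Poly_Mapping.keys c. Poly_Mapping.keys (?\<phi> p))"
    by (rule keys_frag_extend)
  also have "\<dots> \<subseteq> carrier G' \<times> carrier H'"
    using c assms by (auto simp: keys_frag_of hom_def Pi_def)
  finally show "frag_extend ?\<phi> c \<in> carrier (free_Abelian_group (carrier G' \<times> carrier H'))"
    by simp
qed (simp add: frag_extend_add)

lemma tensor_map_coset:
  assumes "group G" "group H" "group G'" "group H'" "f \<in> hom G G'" "g \<in> hom H H'"
    and c: "c \<in> carrier (free_Abelian_group (carrier G \<times> carrier H))"
  shows "tensor_map G' H' f g
           (tensor_kernel G H #>\<^bsub>free_Abelian_group (carrier G \<times> carrier H)\<^esub> c) =
         tensor_kernel G' H' #>\<^bsub>free_Abelian_group (carrier G' \<times> carrier H')\<^esub>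
           frag_extend (\<lambda>(x, y). frag_of (f x, g y)) c"
proof -
  let ?F = "free_Abelian_group (carrier G \<times> carrier H)"
  let ?F' = "free_Abelian_group (carrier G' \<times> carrier H')"
  let ?\<phi> = "frag_extend (\<lambda>(x, y). frag_of (f x, g y)) :: ('a \<times> 'c \<Rightarrow>\<^sub>0 int) \<Rightarrow> _"
  interpret G: group G by fact
  interpret H: group H by fact
  interpret G': group G' by fact
  interpret H': group H' by fact
  interpret \<phi>: group_hom ?F ?F' ?\<phi>
    using frag_extend_hom[OF assms(5,6)] by (simp add: group_hom_def group_hom_axioms_def)
  interpret N: normal "tensor_kernel G H" ?F
    using tensor_kernel_normal assms by blast
  interpret N': normal "tensor_kernel G' H'" ?F'
    using tensor_kernel_normal assms by blast
  have relators: "?\<phi> r \<in> tensor_relators G' H'" if "r \<in> tensor_relators G H" for r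
    using that unfolding tensor_relators_def
  proof (elim UnE CollectE exE conjE)
    fix x x' y
    assume r: "r = frag_of (x \<otimes>\<^bsub>G\<^esub> x', y) - frag_of (x, y) - frag_of (x', y)"
      and xy: "x \<in> carrier G" "x' \<in> carrier G" "y \<in> carrier H"
    have "?\<phi> r = frag_of (f x \<otimes>\<^bsub>G'\<^esub> f x', g y) - frag_of (f x, g y) - frag_of (f x', g y)"
      using xy assms(5) by (simp add: r frag_extend_diff hom_mult)
    moreover have "f x \<in> carrier G'" "f x' \<in> carrier G'" "g y \<in> carrier H'"
      using xy assms(5,6) by (auto intro: hom_in_carrier)
    ultimately show "?\<phi> r \<in> {frag_of (x \<otimes>\<^bsub>G'\<^esub> x', y) - frag_of (x, y) - frag_of (x', y) | x x' y.
          x \<in> carrier G' \<and> x' \<in> carrier G' \<and> y \<in> carrier H'} \<union>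
        {frag_of (x, y \<otimes>\<^bsub>H'\<^esub> y') - frag_of (x, y) - frag_of (x, y') | x y y'.
          x \<in> carrier G' \<and> y \<in> carrier H' \<and> y' \<in> carrier H'}" by blast
  next
    fix x y y'
    assume r: "r = frag_of (x, y \<otimes>\<^bsub>H\<^esub> y') - frag_of (x, y) - frag_of (x, y')"
      and xy: "x \<in> carrier G" "y \<in> carrier H" "y' \<in> carrier H"
    have "?\<phi> r = frag_of (f x, g y \<otimes>\<^bsub>H'\<^esub> g y') - frag_of (f x, g y) - frag_of (f x, g y')"
      using xy assms(6) by (simp add: r frag_extend_diff hom_mult)
    moreover have "f x \<in> carrier G'" "g y \<in> carrier H'" "g y' \<in> carrier H'"
      using xy assms(5,6) by (auto intro: hom_in_carrier)
    ultimately show "?\<phi> r \<in> {frag_of (x \<otimes>\<^bsub>G'\<^esub> x', y) - frag_of (x, y) - frag_of (x', y) | x x' y.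
          x \<in> carrier G' \<and> x' \<in> carrier G' \<and> y \<in> carrier H'} \<union>
        {frag_of (x, y \<otimes>\<^bsub>H'\<^esub> y') - frag_of (x, y) - frag_of (x, y') | x y y'.
          x \<in> carrier G' \<and> y \<in> carrier H' \<and> y' \<in> carrier H'}" by blast
  qed
  have "?\<phi> ` tensor_kernel G H = generate ?F' (?\<phi> ` tensor_relators G H)"
    unfolding tensor_kernel_def
    by (rule \<phi>.generate_img[symmetric]) (rule tensor_relators_subset[OF assms(1,2)])
  also have "\<dots> \<subseteq> tensor_kernel G' H'"
    unfolding tensor_kernel_def by (rule \<phi>.H.mono_generate) (use relators in blast)
  finally have kernel: "?\<phi> ` tensor_kernel G H \<subseteq> tensor_kernel G' H'" .
  have add: "?\<phi> (a + b) = ?\<phi> a + ?\<phi> b" for a b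
    by (rule frag_extend_add)
  show ?thesis
  proof
    show "tensor_map G' H' f g (tensor_kernel G H #>\<^bsub>?F\<^esub> c) \<subseteq> tensor_kernel G' H' #>\<^bsub>?F'\<^esub> ?\<phi> c"
    proof
      fix z assume "z \<in> tensor_map G' H' f g (tensor_kernel G H #>\<^bsub>?F\<^esub> c)"
      then obtain k m where k: "k \<in> tensor_kernel G' H'" and m: "m \<in> tensor_kernel G H"
        and z: "z = k + (?\<phi> m + ?\<phi> c)"
        by (auto simp: tensor_map_def set_mult_def r_coset_def add)
      have "k + ?\<phi> m \<in> tensor_kernel G' H'"
        using N'.m_closed[OF k, of "?\<phi> m"] kernel m by auto
      then show "z \<in> tensor_kernel G' H' #>\<^bsub>?F'\<^esub> ?\<phi> c"
        by (auto simp: r_coset_def z add.assoc)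
    qed
    show "tensor_kernel G' H' #>\<^bsub>?F'\<^esub> ?\<phi> c \<subseteq> tensor_map G' H' f g (tensor_kernel G H #>\<^bsub>?F\<^esub> c)"
    proof -
      have "0 \<in> tensor_kernel G H" using N.one_closed by simp
      then have "c \<in> tensor_kernel G H #>\<^bsub>?F\<^esub> c" by (force simp: r_coset_def)
      then show ?thesis by (force simp: tensor_map_def set_mult_def r_coset_def)
    qed
  qed
qed

lemma tensor_map_pure_tensor:
  assumes "group G" "group H" "group G'" "group H'" "f \<in> hom G G'" "g \<in> hom H H'"
    and "x \<in> carrier G" "y \<in> carrier H"
  shows "tensor_map G' H' f g (pure_tensor G H x y) = pure_tensor G' H' (f x) (g y)"
  using assms by (simp add: pure_tensor_def tensor_map_coset)

lemma tensor_map_hom: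
  assumes "group G" "group H" "group G'" "group H'" "f \<in> hom G G'" "g \<in> hom H H'"
  shows "tensor_map G' H' f g \<in> hom (tensor_group G H) (tensor_group G' H')"
proof -
  let ?F = "free_Abelian_group (carrier G \<times> carrier H)"
  let ?F' = "free_Abelian_group (carrier G' \<times> carrier H')"
  let ?\<phi> = "frag_extend (\<lambda>(x, y). frag_of (f x, g y)) :: ('a \<times> 'c \<Rightarrow>\<^sub>0 int) \<Rightarrow> _"
  interpret \<phi>: group_hom ?F ?F' ?\<phi>
    using frag_extend_hom[OF assms(5,6)] by (simp add: group_hom_def group_hom_axioms_def)
  interpret N: normal "tensor_kernel G H" ?F
    using tensor_kernel_normal assms by blast
  interpret N': normal "tensor_kernel G' H'" ?F'
    using tensor_kernel_normal assms by blast
  note coset = tensor_map_coset[OF assms]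
  show ?thesis
  proof (rule homI)
    fix X assume "X \<in> carrier (tensor_group G H)"
    then obtain c where c: "c \<in> carrier ?F" "X = tensor_kernel G H #>\<^bsub>?F\<^esub> c"
      by (auto simp: tensor_group_def FactGroup_def RCOSETS_def)
    then show "tensor_map G' H' f g X \<in> carrier (tensor_group G' H')"
      using \<phi>.hom_closed[OF c(1)]
      by (auto simp: coset tensor_group_def FactGroup_def RCOSETS_def)
  next
    fix X Y assume "X \<in> carrier (tensor_group G H)" "Y \<in> carrier (tensor_group G H)"
    then obtain c d where c: "c \<in> carrier ?F" "X = tensor_kernel G H #>\<^bsub>?F\<^esub> c"
      and d: "d \<in> carrier ?F" "Y = tensor_kernel G H #>\<^bsub>?F\<^esub> d"
      by (auto simp: tensor_group_def FactGroup_def RCOSETS_def)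
    have XY: "X \<otimes>\<^bsub>tensor_group G H\<^esub> Y = tensor_kernel G H #>\<^bsub>?F\<^esub> (c \<otimes>\<^bsub>?F\<^esub> d)"
      using N.rcos_sum[OF c(1) d(1)] c(2) d(2) by (simp add: tensor_group_def FactGroup_def)
    show "tensor_map G' H' f g (X \<otimes>\<^bsub>tensor_group G H\<^esub> Y) =
        tensor_map G' H' f g X \<otimes>\<^bsub>tensor_group G' H'\<^esub> tensor_map G' H' f g Y"
      using N'.rcos_sum[OF \<phi>.hom_closed[OF c(1)] \<phi>.hom_closed[OF d(1)]]
      by (simp only: XY coset[OF \<phi>.G.m_closed[OF c(1) d(1)]] \<phi>.hom_mult[OF c(1) d(1)])
        (simp add: c(2) d(2) coset[OF c(1)] coset[OF d(1)] tensor_group_def FactGroup_def)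
  qed
qed


section \<open>Complexified lattices and the exponential map\<close>

definition complexification :: "('a, 'm) monoid_scheme \<Rightarrow> ('a \<times> complex \<Rightarrow>\<^sub>0 int) set monoid" where
  "complexification L = tensor_group L complex_add_group"

definition lattice_torus :: "('a, 'm) monoid_scheme \<Rightarrow> ('a \<times> complex \<Rightarrow>\<^sub>0 int) set monoid" where
  "lattice_torus L = tensor_group L complex_mult_group"

text \<open>
  \<open>A \<otimes> \<complex>\<close> regarded as a subset of \<open>L \<otimes> \<complex>\<close>: the image of \<open>A \<otimes> \<complex>\<close> under the map
  induced by the inclusion of \<open>A\<close> in \<open>L\<close>.
\<close>

definition complexified_subgroup ::
    "('a, 'm) monoid_scheme \<Rightarrow> 'a set \<Rightarrow> ('a \<times> complex \<Rightarrow>\<^sub>0 int) set set" where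
  "complexified_subgroup L A =
     tensor_map L complex_add_group (\<lambda>x. x) (\<lambda>z. z) `
       carrier (complexification (L\<lparr>carrier := A\<rparr>))"

definition lattice_exp ::
    "('a, 'm) monoid_scheme \<Rightarrow> ('a \<times> complex \<Rightarrow>\<^sub>0 int) set \<Rightarrow> ('a \<times> complex \<Rightarrow>\<^sub>0 int) set" where
  "lattice_exp L =
     tensor_map L complex_mult_group (\<lambda>x. x) (\<lambda>t. exp (2 * of_real pi * \<i> * t))"

end

theory Submission
  imports Defs "HOL-Analysis.Complex_Transcendental"
begin

text \<open>
  Let \<open>V = L \<otimes> \<complex>\<close> and \<open>T = L \<otimes> \<complex>\<^sup>*\<close>. The isomorphism is the connecting homomorphism of the
  sequence \<open>L \<rightarrow> V \<rightarrow> T\<close>, which is exact at \<open>V\<close>. If \<open>x \<in> L\<close> satisfies \<open>x \<otimes> 1 = v + w\<close> with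
  \<open>v \<in> V\<^sub>A\<close> and \<open>w \<in> V\<^sub>B\<close>, then \<open>v\<close> is unique because \<open>V\<^sub>A \<inter> V\<^sub>B = 0\<close>, and \<open>exp v = exp (- w)\<close>
  lies in \<open>exp V\<^sub>A \<inter> exp V\<^sub>B\<close>. Conversely, if \<open>exp v = exp w\<close>, then \<open>v - w\<close> comes from \<open>L\<close>, so
  \<open>x \<mapsto> exp v\<close> is onto. Its kernel is the sum of the inverse images of \<open>V\<^sub>A\<close> and \<open>V\<^sub>B\<close> in \<open>L\<close>.
  This part is pure group theory (\<open>Mod_connecting_iso\<close>).

  It remains to compare \<open>L\<close> with \<open>V\<close> and \<open>T\<close>. A basis of \<open>L\<close> yields coordinates on \<open>V\<close> and \<open>T\<close>
  and hence exactness at \<open>V\<close> (\<open>kernel_lattice_exp\<close>). For a subgroup \<open>N\<close> of \<open>L\<close>, the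
  point \<open>x \<otimes> 1\<close> lies in \<open>V\<^sub>N\<close> if and only if some positive multiple of \<open>x\<close> lies in \<open>N\<close>
  (\<open>integral_in_complexified_iff\<close>); the complex coefficients are made rational by a
  \<open>\<rat>\<close>-linear retraction of \<open>\<complex>\<close> onto \<open>\<rat>\<close>. Thus the inverse images of \<open>V\<^sub>A\<close> and \<open>V\<^sub>B\<close> are \<open>A\<close> and
  \<open>B\<close> by primitivity, while that of \<open>V\<^sub>A + V\<^sub>B\<close> consists of the \<open>x\<close> that are torsion
  modulo \<open>A + B\<close> (\<open>integral_in_sum_iff\<close>).
\<close>


section \<open>Group theory\<close>

lemma hom_finprod:
  assumes "comm_group G" "comm_group H" "h \<in> hom G H" "finite I" "f \<in> I \<rightarrow> carrier G"
  shows "h (finprod G f I) = finprod H (h \<circ> f) I"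
proof -
  interpret G: comm_group G by fact
  interpret H: comm_group H by fact
  interpret h: group_hom G H h using assms by unfold_locales
  show ?thesis using assms(4,5)
    by (induction I rule: finite_induct) (auto simp: Pi_def)
qed

text \<open>
  The connecting homomorphism. Given a sequence \<open>L \<rightarrow> V \<rightarrow> T\<close> of abelian groups exact at \<open>V\<close>
  and subgroups \<open>P\<close>, \<open>Q\<close> of \<open>V\<close> with trivial intersection, send \<open>x\<close> with \<open>j x = p q\<close> to \<open>E p\<close>.
  Since \<open>E p E q = 1\<close>, this lies in \<open>E P \<inter> E Q\<close>, and by exactness every element of
  \<open>E P \<inter> E Q\<close> is obtained. It is trivial exactly if \<open>p\<close>, and then also \<open>q\<close>, comes from \<open>L\<close>.
\<close>

lemma Mod_connecting_iso:
  fixes L :: "('a, 'm) monoid_scheme" and V :: "('b, 'n) monoid_scheme" and T :: "('c, 'k) monoid_scheme"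
  assumes L: "comm_group L" and V: "comm_group V" and T: "comm_group T"
    and j: "j \<in> hom L V" and E: "E \<in> hom V T" and ker: "kernel V T E = j ` carrier L"
    and P: "subgroup P V" and Q: "subgroup Q V" and PQ: "P \<inter> Q = {\<one>\<^bsub>V\<^esub>}"
  shows "L\<lparr>carrier := {x \<in> carrier L. j x \<in> P <#>\<^bsub>V\<^esub> Q}\<rparr> Mod
           ({x \<in> carrier L. j x \<in> P} <#>\<^bsub>L\<^esub> {x \<in> carrier L. j x \<in> Q}) \<cong>
         T\<lparr>carrier := E ` P \<inter> E ` Q\<rparr>"
proof -
  interpret L: comm_group L by fact
  interpret V: comm_group V by fact
  interpret T: comm_group T by fact
  interpret j: group_hom L V j
    using j by unfold_locales
  interpret E: group_hom V T E
    using E by unfold_locales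
  interpret P: subgroup P V by fact
  interpret Q: subgroup Q V by fact
  define W where "W = {x \<in> carrier L. j x \<in> P <#>\<^bsub>V\<^esub> Q}"
  \<comment> \<open>The first component with respect to the direct decomposition \<open>P Q\<close>.\<close>
  define proj where "proj y = (THE p. p \<in> P \<and> (\<exists>q\<in>Q. y = p \<otimes>\<^bsub>V\<^esub> q))" for y
  have proj: "proj (p \<otimes>\<^bsub>V\<^esub> q) = p" if "p \<in> P" "q \<in> Q" for p q
    unfolding proj_def
  proof (rule the_equality)
    fix p' assume "p' \<in> P \<and> (\<exists>q'\<in>Q. p \<otimes>\<^bsub>V\<^esub> q = p' \<otimes>\<^bsub>V\<^esub> q')"
    then obtain q' where p': "p' \<in> P" "q' \<in> Q" "p \<otimes>\<^bsub>V\<^esub> q = p' \<otimes>\<^bsub>V\<^esub> q'" by blast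
    have c: "p \<in> carrier V" "p' \<in> carrier V" "q \<in> carrier V" "q' \<in> carrier V"
      using that p' by auto
    have "p \<otimes>\<^bsub>V\<^esub> inv\<^bsub>V\<^esub> p' = (p \<otimes>\<^bsub>V\<^esub> q) \<otimes>\<^bsub>V\<^esub> inv\<^bsub>V\<^esub> q \<otimes>\<^bsub>V\<^esub> inv\<^bsub>V\<^esub> p'"
      using c by (simp add: V.m_assoc)
    also have "\<dots> = (q' \<otimes>\<^bsub>V\<^esub> inv\<^bsub>V\<^esub> q) \<otimes>\<^bsub>V\<^esub> (p' \<otimes>\<^bsub>V\<^esub> inv\<^bsub>V\<^esub> p')"
      unfolding p'(3) using c by (simp add: V.m_ac del: V.r_inv V.Units_r_inv)
    also have "\<dots> = q' \<otimes>\<^bsub>V\<^esub> inv\<^bsub>V\<^esub> q" using c by simp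
    finally have "p \<otimes>\<^bsub>V\<^esub> inv\<^bsub>V\<^esub> p' = q' \<otimes>\<^bsub>V\<^esub> inv\<^bsub>V\<^esub> q" .
    moreover have "p \<otimes>\<^bsub>V\<^esub> inv\<^bsub>V\<^esub> p' \<in> P" "q' \<otimes>\<^bsub>V\<^esub> inv\<^bsub>V\<^esub> q \<in> Q"
      using that p' by auto
    ultimately have "p \<otimes>\<^bsub>V\<^esub> inv\<^bsub>V\<^esub> p' = \<one>\<^bsub>V\<^esub>" using PQ by auto
    then show "p' = p" using c V.inv_equality by (metis V.inv_inv V.inv_closed)
  qed (use that in blast)
  have dec: "\<exists>p\<in>P. \<exists>q\<in>Q. j x = p \<otimes>\<^bsub>V\<^esub> q" if "x \<in> W" for x
    using that by (auto simp: W_def set_mult_def)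
  interpret PQ: subgroup "P <#>\<^bsub>V\<^esub> Q" V
    by (intro V.mult_subgroups P Q)
  have W: "subgroup W L"
    by unfold_locales (auto simp: W_def)
  have image: "subgroup (E ` P \<inter> E ` Q) T"
    by (intro T.subgroups_Inter_pair E.subgroup_img_is_subgroup P Q)
  let ?G = "L\<lparr>carrier := W\<rparr>" and ?H = "T\<lparr>carrier := E ` P \<inter> E ` Q\<rparr>"
  let ?g = "\<lambda>x. E (proj (j x))"
  have Ej: "E (j x) = \<one>\<^bsub>T\<^esub>" if "x \<in> carrier L" for x
    using ker that by (auto simp: kernel_def)
  \<comment> \<open>Since \<open>E p E q = E (j x) = 1\<close>, the element \<open>E p\<close> lies in \<open>E Q\<close> as well.\<close>
  have Eq: "E p = E (inv\<^bsub>V\<^esub> q)" if "x \<in> W" "p \<in> P" "q \<in> Q" "j x = p \<otimes>\<^bsub>V\<^esub> q" for x p q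
  proof -
    have "E p \<otimes>\<^bsub>T\<^esub> E q = \<one>\<^bsub>T\<^esub>"
      using Ej[of x] that by (simp add: W_def)
    then show ?thesis using that T.inv_equality[of "E p" "E q"] by simp
  qed
  have "?g \<in> hom ?G ?H"
  proof (rule homI)
    show "?g x \<in> carrier ?H" if x: "x \<in> carrier ?G" for x
    proof -
      obtain p q where pq: "p \<in> P" "q \<in> Q" "j x = p \<otimes>\<^bsub>V\<^esub> q"
        using dec[of x] x by auto
      then have "E p = E (inv\<^bsub>V\<^esub> q)" using Eq[of x p q] x by simp
      moreover have "inv\<^bsub>V\<^esub> q \<in> Q" using pq by simp
      ultimately have "E p \<in> E ` P \<inter> E ` Q" using pq by blast
      then show ?thesis using pq by (simp add: proj)
    qed
    show "?g (x \<otimes>\<^bsub>?G\<^esub> y) = ?g x \<otimes>\<^bsub>?H\<^esub> ?g y" if xy: "x \<in> carrier ?G" "y \<in> carrier ?G" for x y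
    proof -
      obtain p q p' q' where pq: "p \<in> P" "q \<in> Q" "p' \<in> P" "q' \<in> Q"
        and jxy: "j x = p \<otimes>\<^bsub>V\<^esub> q" "j y = p' \<otimes>\<^bsub>V\<^esub> q'"
        using dec[of x] dec[of y] xy by auto
      moreover from this have "j (x \<otimes>\<^bsub>L\<^esub> y) = (p \<otimes>\<^bsub>V\<^esub> p') \<otimes>\<^bsub>V\<^esub> (q \<otimes>\<^bsub>V\<^esub> q')"
        using xy by (simp add: W_def V.m_ac)
      ultimately have "proj (j (x \<otimes>\<^bsub>L\<^esub> y)) = proj (j x) \<otimes>\<^bsub>V\<^esub> proj (j y)"
        by (simp add: proj)
      moreover have "proj (j x) \<in> P" "proj (j y) \<in> P"
        using pq jxy by (simp_all add: proj)
      ultimately show ?thesis by simp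
    qed
  qed
  then interpret g: group_hom ?G ?H ?g
    by (intro group_hom.intro group_hom_axioms.intro L.subgroup_imp_group T.subgroup_imp_group W image)
  have onto: "?g ` carrier ?G = carrier ?H"
  proof
    show "?g ` carrier ?G \<subseteq> carrier ?H"
      by (rule image_subsetI) (rule g.hom_closed)
    show "carrier ?H \<subseteq> ?g ` carrier ?G"
    proof
      fix t assume "t \<in> carrier ?H"
      then obtain p q where pq: "p \<in> P" "q \<in> Q" "t = E p" "t = E q" by auto
      then have "E (p \<otimes>\<^bsub>V\<^esub> inv\<^bsub>V\<^esub> q) = \<one>\<^bsub>T\<^esub>" by simp
      then have "p \<otimes>\<^bsub>V\<^esub> inv\<^bsub>V\<^esub> q \<in> j ` carrier L"
        using pq by (simp flip: ker add: kernel_def)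
      then obtain x where x: "x \<in> carrier L" "j x = p \<otimes>\<^bsub>V\<^esub> inv\<^bsub>V\<^esub> q" by auto
      moreover have "inv\<^bsub>V\<^esub> q \<in> Q" using pq by simp
      ultimately have "x \<in> W"
        using pq unfolding W_def set_mult_def by blast
      moreover have "?g x = t" using x pq by (simp add: proj)
      ultimately show "t \<in> ?g ` carrier ?G" by auto
    qed
  qed
  have "kernel ?G ?H ?g = {x \<in> carrier L. j x \<in> P} <#>\<^bsub>L\<^esub> {x \<in> carrier L. j x \<in> Q}"
  proof (intro equalityI subsetI)
    fix x assume "x \<in> kernel ?G ?H ?g"
    then have x: "x \<in> W" "?g x = \<one>\<^bsub>T\<^esub>" by (auto simp: kernel_def)
    then obtain p q where pq: "p \<in> P" "q \<in> Q" "j x = p \<otimes>\<^bsub>V\<^esub> q"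
      using dec by blast
    then have "E p = \<one>\<^bsub>T\<^esub>" using x by (simp add: proj)
    then have "p \<in> j ` carrier L" using pq by (simp flip: ker add: kernel_def)
    then obtain y where y: "y \<in> carrier L" "p = j y" by auto
    have xL: "x \<in> carrier L" using x by (simp add: W_def)
    have "j (inv\<^bsub>L\<^esub> y \<otimes>\<^bsub>L\<^esub> x) = inv\<^bsub>V\<^esub> p \<otimes>\<^bsub>V\<^esub> (p \<otimes>\<^bsub>V\<^esub> q)"
      using y pq xL by simp
    also have "\<dots> = q" using pq by (simp add: V.m_assoc[symmetric])
    finally have "j (inv\<^bsub>L\<^esub> y \<otimes>\<^bsub>L\<^esub> x) \<in> Q" using pq by simp
    moreover have "x = y \<otimes>\<^bsub>L\<^esub> (inv\<^bsub>L\<^esub> y \<otimes>\<^bsub>L\<^esub> x)"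
      using y xL by (simp add: L.m_assoc[symmetric])
    ultimately show "x \<in> {x \<in> carrier L. j x \<in> P} <#>\<^bsub>L\<^esub> {x \<in> carrier L. j x \<in> Q}"
      using y xL pq(1) unfolding set_mult_def by blast
  next
    fix x assume "x \<in> {x \<in> carrier L. j x \<in> P} <#>\<^bsub>L\<^esub> {x \<in> carrier L. j x \<in> Q}"
    then obtain y z where yz: "y \<in> carrier L" "z \<in> carrier L" "j y \<in> P" "j z \<in> Q" "x = y \<otimes>\<^bsub>L\<^esub> z"
      by (auto simp: set_mult_def)
    then have "j x = j y \<otimes>\<^bsub>V\<^esub> j z" by simp
    moreover from this have "x \<in> W" using yz by (auto simp: W_def set_mult_def)
    ultimately show "x \<in> kernel ?G ?H ?g" using yz by (simp add: kernel_def proj Ej)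
  qed
  then show ?thesis using g.FactGroup_iso[OF onto] by (simp add: W_def)
qed

lemma torsion_subgroup_Mod:
  assumes "comm_group L" "subgroup N L"
  shows "torsion_subgroup (L Mod N) =
    (\<lambda>x. N #>\<^bsub>L\<^esub> x) ` {x \<in> carrier L. \<exists>k::nat. k > 0 \<and> x [^]\<^bsub>L\<^esub> k \<in> N}"
proof -
  interpret comm_group L by fact
  interpret N: normal N L using assms(2) by (simp add: normal_iff_subgroup)
  have "N #>\<^bsub>L\<^esub> y = N \<longleftrightarrow> y \<in> N" if "y \<in> carrier L" for y
    using that coset_join1[of N y] coset_join2[of y N] N.subgroup_axioms by blast
  then show ?thesis
    by (auto simp: torsion_subgroup_def carrier_FactGroup N.FactGroup_pow intro!: imageI)
qed

text \<open>
  A primitive sublattice contains every element of \<open>L\<close> that has a positive multiple in it.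
\<close>

lemma primitive_sublatticeD:
  assumes L: "comm_group L" and A: "primitive_sublattice A L"
    and x: "x \<in> carrier L" "(k::nat) > 0" "x [^]\<^bsub>L\<^esub> k \<in> A"
  shows "x \<in> A"
proof -
  interpret comm_group L by fact
  have sub: "subgroup A L" and tors: "torsion_subgroup (L Mod A) = {A}"
    using A by (auto simp: primitive_sublattice_def)
  have "A #>\<^bsub>L\<^esub> x \<in> torsion_subgroup (L Mod A)"
    using x by (auto simp: torsion_subgroup_Mod[OF L sub])
  then show ?thesis using tors x(1) sub by (auto intro: coset_join1)
qed


section \<open>Tensor products of abelian groups\<close>

lemma pure_tensor_closed:
  assumes "x \<in> carrier G" "y \<in> carrier H"
  shows "pure_tensor G H x y \<in> carrier (tensor_group G H)"
  using assms by (simp add: pure_tensor_def tensor_group_def carrier_FactGroup)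

lemma tensor_coset_eqI:
  assumes "group G" "group H" and "c \<in> carrier (free_Abelian_group (carrier G \<times> carrier H))"
    and "d \<in> carrier (free_Abelian_group (carrier G \<times> carrier H))"
    and "c - d \<in> tensor_relators G H"
  shows "tensor_kernel G H #>\<^bsub>free_Abelian_group (carrier G \<times> carrier H)\<^esub> c =
         tensor_kernel G H #>\<^bsub>free_Abelian_group (carrier G \<times> carrier H)\<^esub> d"
proof -
  let ?F = "free_Abelian_group (carrier G \<times> carrier H)"
  interpret F: comm_group ?F by (rule abelian_free_Abelian_group)
  interpret N: normal "tensor_kernel G H" ?F
    by (rule tensor_kernel_normal) fact+
  have "c - d \<in> tensor_kernel G H"
    unfolding tensor_kernel_def using assms(5) by (rule generate.incl)
  then have "c \<in> tensor_kernel G H #>\<^bsub>?F\<^esub> d"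
    by (force simp: r_coset_def)
  then show ?thesis
    using F.repr_independence[of c _ d] assms(4) N.subgroup_axioms by simp
qed

lemma tensor_coset_mult:
  assumes "group G" "group H" and "c \<in> carrier (free_Abelian_group (carrier G \<times> carrier H))"
    and "d \<in> carrier (free_Abelian_group (carrier G \<times> carrier H))"
  shows "(tensor_kernel G H #>\<^bsub>free_Abelian_group (carrier G \<times> carrier H)\<^esub> c) \<otimes>\<^bsub>tensor_group G H\<^esub>
         (tensor_kernel G H #>\<^bsub>free_Abelian_group (carrier G \<times> carrier H)\<^esub> d) =
         tensor_kernel G H #>\<^bsub>free_Abelian_group (carrier G \<times> carrier H)\<^esub> (c + d)"
  using normal.rcos_sum[OF tensor_kernel_normal[OF assms(1,2)] assms(3,4)]
  by (simp add: tensor_group_def)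

lemma pure_tensor_hom_left:
  assumes "group G" "group H" "y \<in> carrier H"
  shows "(\<lambda>x. pure_tensor G H x y) \<in> hom G (tensor_group G H)"
proof (rule homI)
  interpret G: group G by fact
  fix x x' assume x: "x \<in> carrier G" "x' \<in> carrier G"
  show "pure_tensor G H (x \<otimes>\<^bsub>G\<^esub> x') y =
      pure_tensor G H x y \<otimes>\<^bsub>tensor_group G H\<^esub> pure_tensor G H x' y"
    unfolding pure_tensor_def
  proof (subst tensor_coset_mult[OF assms(1,2)])
    show "tensor_kernel G H #>\<^bsub>free_Abelian_group (carrier G \<times> carrier H)\<^esub> frag_of (x \<otimes>\<^bsub>G\<^esub> x', y) =
        tensor_kernel G H #>\<^bsub>free_Abelian_group (carrier G \<times> carrier H)\<^esub> (frag_of (x, y) + frag_of (x', y))"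
    proof (rule tensor_coset_eqI[OF assms(1,2)])
      have "frag_of (x \<otimes>\<^bsub>G\<^esub> x', y) - frag_of (x, y) - frag_of (x', y) \<in> tensor_relators G H"
        unfolding tensor_relators_def using x assms(3) by blast
      then show "frag_of (x \<otimes>\<^bsub>G\<^esub> x', y) - (frag_of (x, y) + frag_of (x', y)) \<in> tensor_relators G H"
        by (simp add: diff_diff_eq)
      show "frag_of (x, y) + frag_of (x', y) \<in> carrier (free_Abelian_group (carrier G \<times> carrier H))"
        using x assms(3) keys_add[of "frag_of (x, y)" "frag_of (x', y)"] by auto
    qed (use x assms(3) in simp)
  qed (use x assms(3) in simp_all)
qed (use assms in \<open>simp add: pure_tensor_closed\<close>)

lemma pure_tensor_hom_right:
  assumes "group G" "group H" "x \<in> carrier G"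
  shows "(\<lambda>y. pure_tensor G H x y) \<in> hom H (tensor_group G H)"
proof (rule homI)
  interpret H: group H by fact
  fix y y' assume y: "y \<in> carrier H" "y' \<in> carrier H"
  show "pure_tensor G H x (y \<otimes>\<^bsub>H\<^esub> y') =
      pure_tensor G H x y \<otimes>\<^bsub>tensor_group G H\<^esub> pure_tensor G H x y'"
    unfolding pure_tensor_def
  proof (subst tensor_coset_mult[OF assms(1,2)])
    show "tensor_kernel G H #>\<^bsub>free_Abelian_group (carrier G \<times> carrier H)\<^esub> frag_of (x, y \<otimes>\<^bsub>H\<^esub> y') =
        tensor_kernel G H #>\<^bsub>free_Abelian_group (carrier G \<times> carrier H)\<^esub> (frag_of (x, y) + frag_of (x, y'))"
    proof (rule tensor_coset_eqI[OF assms(1,2)])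
      have "frag_of (x, y \<otimes>\<^bsub>H\<^esub> y') - frag_of (x, y) - frag_of (x, y') \<in> tensor_relators G H"
        unfolding tensor_relators_def using y assms(3) by blast
      then show "frag_of (x, y \<otimes>\<^bsub>H\<^esub> y') - (frag_of (x, y) + frag_of (x, y')) \<in> tensor_relators G H"
        by (simp add: diff_diff_eq)
      show "frag_of (x, y) + frag_of (x, y') \<in> carrier (free_Abelian_group (carrier G \<times> carrier H))"
        using y assms(3) keys_add[of "frag_of (x, y)" "frag_of (x, y')"] by auto
    qed (use y assms(3) in simp)
  qed (use y assms(3) in simp_all)
qed (use assms in \<open>simp add: pure_tensor_closed\<close>)

text \<open>
  Pure tensors generate the tensor product. The neutral element needs no case of its own,
  being the quotient of a pure tensor by itself.
\<close>

lemma tensor_group_induct [consumes 3, case_names pure diff]: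
  assumes "group G" "group H" and X: "X \<in> carrier (tensor_group G H)"
    and pure: "\<And>x y. x \<in> carrier G \<Longrightarrow> y \<in> carrier H \<Longrightarrow> P (pure_tensor G H x y)"
    and diff: "\<And>X Y. X \<in> carrier (tensor_group G H) \<Longrightarrow> Y \<in> carrier (tensor_group G H) \<Longrightarrow>
      P X \<Longrightarrow> P Y \<Longrightarrow> P (X \<otimes>\<^bsub>tensor_group G H\<^esub> inv\<^bsub>tensor_group G H\<^esub> Y)"
  shows "P X"
proof -
  let ?F = "free_Abelian_group (carrier G \<times> carrier H)" and ?T = "tensor_group G H"
  let ?q = "\<lambda>c. tensor_kernel G H #>\<^bsub>?F\<^esub> c"
  interpret G: group G by fact
  interpret H: group H by fact
  interpret F: comm_group ?F by (rule abelian_free_Abelian_group)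
  interpret T: comm_group ?T by (rule comm_group_tensor_group) fact+
  interpret q: group_hom ?F ?T ?q
    using normal.r_coset_hom_Mod[OF tensor_kernel_normal[OF assms(1,2)]]
    by unfold_locales (simp add: tensor_group_def)
  obtain c where c: "c \<in> carrier ?F" "X = ?q c"
    using X by (auto simp: tensor_group_def carrier_FactGroup)
  have "Poly_Mapping.keys c \<subseteq> carrier G \<times> carrier H" using c by simp
  then have "P (?q c)"
  proof (induction c rule: free_Abelian_group_induct[consumes 1, case_names zero diff one])
    case zero
    have "pure_tensor G H \<one>\<^bsub>G\<^esub> \<one>\<^bsub>H\<^esub> \<in> carrier ?T" by (simp add: pure_tensor_closed)
    then have "P \<one>\<^bsub>?T\<^esub>"
      using diff[of "pure_tensor G H \<one>\<^bsub>G\<^esub> \<one>\<^bsub>H\<^esub>" "pure_tensor G H \<one>\<^bsub>G\<^esub> \<one>\<^bsub>H\<^esub>"] pure[of "\<one>\<^bsub>G\<^esub>" "\<one>\<^bsub>H\<^esub>"]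
      by simp
    then show ?case using q.hom_one by simp
  next
    case (diff c d)
    have cd: "c \<in> carrier ?F" "d \<in> carrier ?F" using diff by simp_all
    then have "?q (c - d) = ?q c \<otimes>\<^bsub>?T\<^esub> inv\<^bsub>?T\<^esub> ?q d"
      using q.hom_mult[of c "-d"] q.hom_inv[of d] by simp
    then show ?case using diff assms(5)[of "?q c" "?q d"] q.hom_closed[OF cd(1)] q.hom_closed[OF cd(2)] by simp
  next
    case (one a)
    then show ?case using pure[of "fst a" "snd a"] by (auto simp: pure_tensor_def)
  qed
  then show ?thesis using c by simp
qed

text \<open>
  The universal property of the tensor product, for biadditive maps \<open>f\<close>.
\<close>

lemma tensor_group_universal:
  fixes K :: "('c, 'k) monoid_scheme"
  assumes G: "group G" and H: "group H" and K: "comm_group K"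
    and l: "\<And>y. y \<in> carrier H \<Longrightarrow> (\<lambda>x. f x y) \<in> hom G K"
    and r: "\<And>x. x \<in> carrier G \<Longrightarrow> (\<lambda>y. f x y) \<in> hom H K"
  obtains h where "h \<in> hom (tensor_group G H) K"
    "\<And>x y. x \<in> carrier G \<Longrightarrow> y \<in> carrier H \<Longrightarrow> h (pure_tensor G H x y) = f x y"
proof -
  let ?F = "free_Abelian_group (carrier G \<times> carrier H)"
  interpret G: group G by fact
  interpret H: group H by fact
  interpret K: comm_group K by fact
  interpret F: comm_group ?F by (rule abelian_free_Abelian_group)
  have f: "f x y \<in> carrier K" if "x \<in> carrier G" "y \<in> carrier H" for x y
    using hom_in_carrier[OF r] that by simp
  obtain u where u: "u \<in> hom ?F K" "\<And>p. p \<in> carrier G \<times> carrier H \<Longrightarrow> u (frag_of p) = case_prod f p"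
    using K.free_Abelian_group_universal[of "case_prod f" "carrier G \<times> carrier H"] f
    by (smt (verit) image_subset_iff mem_Sigma_iff case_prod_conv prod.collapse split_beta)
  interpret u: group_hom ?F K u using u by unfold_locales
  have diff: "u (c - d - e) = u c \<otimes>\<^bsub>K\<^esub> inv\<^bsub>K\<^esub> (u d) \<otimes>\<^bsub>K\<^esub> inv\<^bsub>K\<^esub> (u e)"
    if "c \<in> carrier ?F" "d \<in> carrier ?F" "e \<in> carrier ?F" for c d e
    using that u.hom_mult[of "c + (-d)" "-e"] u.hom_mult[of c "-d"] u.hom_inv[of d] u.hom_inv[of e]
      F.m_closed[of c "-d"] F.inv_closed[of d] F.inv_closed[of e]
    by simp
  have "tensor_relators G H \<subseteq> kernel ?F K u"
  proof
    fix s assume s: "s \<in> tensor_relators G H"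
    then have "s \<in> carrier ?F" using tensor_relators_subset[OF G H] by blast
    moreover have "u s = \<one>\<^bsub>K\<^esub>"
      using s unfolding tensor_relators_def
    proof (elim UnE CollectE exE conjE)
      fix x x' y assume "s = frag_of (x \<otimes>\<^bsub>G\<^esub> x', y) - frag_of (x, y) - frag_of (x', y)"
        and "x \<in> carrier G" "x' \<in> carrier G" "y \<in> carrier H"
      then show ?thesis using hom_mult[OF l, of y x x'] f[of x y] f[of x' y]
        by (simp add: diff u(2) K.m_ac K.inv_mult[symmetric])
    next
      fix x y y' assume "s = frag_of (x, y \<otimes>\<^bsub>H\<^esub> y') - frag_of (x, y) - frag_of (x, y')"
        and "x \<in> carrier G" "y \<in> carrier H" "y' \<in> carrier H"
      then show ?thesis using hom_mult[OF r, of x y y'] f[of x y] f[of x y']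
        by (simp add: diff u(2) K.m_ac K.inv_mult[symmetric])
    qed
    ultimately show "s \<in> kernel ?F K u" by (simp add: kernel_def)
  qed
  then have "tensor_kernel G H \<subseteq> kernel ?F K u"
    unfolding tensor_kernel_def by (rule F.generate_subgroup_incl) (rule u.subgroup_kernel)
  then obtain h where "h \<in> hom (?F Mod tensor_kernel G H) K"
      "\<And>c. c \<in> carrier ?F \<Longrightarrow> h (tensor_kernel G H #>\<^bsub>?F\<^esub> c) = u c"
    using u.FactGroup_universal_kernel[OF tensor_kernel_normal[OF G H]] by blast
  then show thesis
    using that[of h] u(2) by (simp add: tensor_group_def pure_tensor_def)
qed


section \<open>The additive and multiplicative groups of complex numbers\<close>

lemma comm_group_complex_add: "comm_group complex_add_group"
  unfolding complex_add_group_def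
  by (rule comm_groupI) (auto simp: algebra_simps intro: exI[of _ "- _"])

lemma comm_group_complex_mult: "comm_group complex_mult_group"
  unfolding complex_mult_group_def
proof (rule comm_groupI, goal_cases)
  case (6 x)
  then show ?case by (auto intro!: bexI[of _ "inverse x"])
qed auto

lemma exp_2pi_i_eq_1_iff: "exp (2 * of_real pi * \<i> * t) = 1 \<longleftrightarrow> (\<exists>m::int. t = of_int m)"
proof
  assume "exp (2 * of_real pi * \<i> * t) = 1"
  then obtain m :: int where "Im t = 0" "2 * pi * Re t = 2 * of_int m * pi"
    unfolding exp_eq_1 by auto
  then have "t = of_int m" by (simp add: complex_eq_iff)
  then show "\<exists>m::int. t = of_int m" ..
next
  assume "\<exists>m::int. t = of_int m"
  then show "exp (2 * of_real pi * \<i> * t) = 1"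
    unfolding exp_eq_1 by (auto simp: mult_ac)
qed

lemma complex_add_group_simps [simp]:
  "carrier complex_add_group = UNIV" "x \<otimes>\<^bsub>complex_add_group\<^esub> y = x + y" "\<one>\<^bsub>complex_add_group\<^esub> = 0"
  by (simp_all add: complex_add_group_def)

lemma complex_mult_group_simps [simp]:
  "carrier complex_mult_group = - {0}" "x \<otimes>\<^bsub>complex_mult_group\<^esub> y = x * y" "\<one>\<^bsub>complex_mult_group\<^esub> = 1"
  by (simp_all add: complex_mult_group_def)

lemma inv_complex_add_group [simp]: "inv\<^bsub>complex_add_group\<^esub> x = - x"
proof -
  interpret comm_group complex_add_group by (rule comm_group_complex_add)
  show ?thesis by (rule inv_equality) auto
qed

lemma int_pow_complex_add_group [simp]: "x [^]\<^bsub>complex_add_group\<^esub> (k::int) = of_int k * x"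
proof -
  have nat: "x [^]\<^bsub>complex_add_group\<^esub> (n::nat) = of_nat n * x" for n
    by (induction n) (auto simp: nat_pow_def algebra_simps)
  interpret comm_group complex_add_group by (rule comm_group_complex_add)
  show ?thesis by (cases k rule: int_cases2) (simp_all add: int_pow_int int_pow_neg_int nat)
qed

text \<open>
  A \<open>\<rat>\<close>-linear retraction of \<open>\<complex>\<close> onto \<open>\<rat>\<close>, obtained by extending \<open>1\<close> to a Hamel basis.
  Only its \<open>\<int>\<close>-linearity is recorded.
\<close>

lemma rational_functional:
  obtains p :: "complex \<Rightarrow> rat"
  where "\<And>x y. p (x - y) = p x - p y" "\<And>m z. p (of_int m * z) = of_int m * p z" "p 1 = 1"
proof -
  interpret vector_space_pair "\<lambda>q (z::complex). of_rat q * z" "(*) :: rat \<Rightarrow> rat \<Rightarrow> rat"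
    by unfold_locales (simp_all add: algebra_simps of_rat_add of_rat_mult)
  have "vs1.independent {1}" by (simp add: vs1.dependent_single)
  then obtain p where p: "Vector_Spaces.linear (\<lambda>q (z::complex). of_rat q * z) (*) p" "p 1 = 1"
    using linear_independent_extend[of "{1}" "\<lambda>_. 1"] by auto
  interpret p: Vector_Spaces.linear "\<lambda>q (z::complex). of_rat q * z" "(*)" p by fact
  show thesis
  proof
    show "p (x - y) = p x - p y" for x y by (rule p.diff)
    show "p (of_int m * z) = of_int m * p z" for m z
      using p.scale[of "of_int m" z] by simp
  qed fact
qed


section \<open>Coordinates and the kernel of the exponential map\<close>

text \<open>
  A lattice \<open>L\<close> with a basis \<open>e 0, \<dots>, e (n - 1)\<close> and its integer coordinates.
  Only the coordinates with index below \<open>n\<close> need to separate elements; \<open>coord\<close> is additive and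
  takes the expected values on the basis for every index, which saves side conditions.
\<close>

locale lattice_with_basis = comm_group L for L :: "('a, 'm) monoid_scheme" (structure) +
  fixes n :: nat and e :: "nat \<Rightarrow> 'a" and coord :: "'a \<Rightarrow> nat \<Rightarrow> int"
  assumes basis_closed: "i < n \<Longrightarrow> e i \<in> carrier L"
    and coord_basis: "i < n \<Longrightarrow> coord (e i) k = (if i = k then 1 else 0)"
    and coord_mult: "x \<in> carrier L \<Longrightarrow> y \<in> carrier L \<Longrightarrow> coord (x \<otimes> y) k = coord x k + coord y k"
    and coord_inject: "x \<in> carrier L \<Longrightarrow> y \<in> carrier L \<Longrightarrow>
      (\<And>k. k < n \<Longrightarrow> coord x k = coord y k) \<Longrightarrow> x = y"

lemma lattice_with_basis_exists:
  fixes L :: "('a, 'm) monoid_scheme"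
  assumes L: "comm_group L" and iso: "L \<cong> free_Abelian_group {..<n}"
  obtains e coord where "lattice_with_basis L n e coord"
proof -
  let ?F = "free_Abelian_group {..<n}"
  interpret L: comm_group L by fact
  obtain h where h: "h \<in> hom L ?F" "bij_betw h (carrier L) (carrier ?F)"
    using iso by (auto simp: is_iso_def iso_def)
  define e where "e i = inv_into (carrier L) h (frag_of i)" for i
  have e: "e i \<in> carrier L" "h (e i) = frag_of i" if "i < n" for i
  proof -
    have "frag_of i \<in> h ` carrier L" using h(2) that by (simp add: bij_betw_def)
    then show "e i \<in> carrier L" "h (e i) = frag_of i"
      unfolding e_def by (rule inv_into_into, rule f_inv_into_f)
  qed
  have "lattice_with_basis L n e (\<lambda>x. Poly_Mapping.lookup (h x))"
  proof
    show "Poly_Mapping.lookup (h (x \<otimes>\<^bsub>L\<^esub> y)) k = Poly_Mapping.lookup (h x) k + Poly_Mapping.lookup (h y) k"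
      if "x \<in> carrier L" "y \<in> carrier L" for x y k
      using hom_mult[OF h(1)] that by (simp add: lookup_add)
    show "x = y" if xy: "x \<in> carrier L" "y \<in> carrier L"
      and eq: "\<And>k. k < n \<Longrightarrow> Poly_Mapping.lookup (h x) k = Poly_Mapping.lookup (h y) k" for x y
    proof -
      have "Poly_Mapping.keys (h x) \<subseteq> {..<n}" "Poly_Mapping.keys (h y) \<subseteq> {..<n}"
        using hom_in_carrier[OF h(1)] xy by simp_all
      then have "Poly_Mapping.lookup (h x) k = Poly_Mapping.lookup (h y) k" for k
        using eq[of k] by (metis in_keys_iff lessThan_iff subsetD)
      then have "h x = h y" by (rule poly_mapping_eqI)
      then show "x = y" using h(2) xy by (auto simp: bij_betw_def inj_on_def)
    qed
  qed (use e in \<open>auto simp: lookup_frag_of\<close>)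
  then show thesis by (rule that)
qed

context lattice_with_basis begin

text \<open>
  \<open>V\<close> is \<open>L \<otimes> \<complex>\<close>, \<open>T\<close> is \<open>L \<otimes> \<complex>\<^sup>*\<close>, and \<open>x \<otimes>\<^sub>V z\<close> is a pure tensor in \<open>V\<close>.
\<close>

abbreviation "V \<equiv> complexification L"
abbreviation "T \<equiv> lattice_torus L"
abbreviation vec (infixl "\<otimes>\<^sub>V" 71) where "x \<otimes>\<^sub>V z \<equiv> pure_tensor L complex_add_group x z"

lemma coord_one: "coord \<one> k = 0"
  using coord_mult[of \<one> \<one> k] by simp

lemma coord_inv: "x \<in> carrier L \<Longrightarrow> coord (inv x) k = - coord x k"
  using coord_mult[of x "inv x" k] by (simp add: coord_one)

lemma coord_nat_pow: "x \<in> carrier L \<Longrightarrow> coord (x [^] (m::nat)) k = int m * coord x k"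
  by (induction m) (simp_all add: coord_one coord_mult algebra_simps)

lemma coord_int_pow: "x \<in> carrier L \<Longrightarrow> coord (x [^] (m::int)) k = m * coord x k"
  by (cases m rule: int_cases2)
    (simp_all add: int_pow_int int_pow_neg_int coord_nat_pow coord_inv)

lemma coord_finprod:
  "finite I \<Longrightarrow> f \<in> I \<rightarrow> carrier L \<Longrightarrow> coord (finprod L f I) k = (\<Sum>i\<in>I. coord (f i) k)"
  by (induction I rule: finite_induct) (auto simp: coord_one coord_mult Pi_def)

lemma coord_combination:
  "k < n \<Longrightarrow> coord (\<Otimes>i\<in>{..<n}. e i [^] (m i :: int)) k = m k"
  by (subst coord_finprod) (auto simp: basis_closed coord_int_pow coord_basis if_distrib cong: if_cong)

lemma basis_expansion: "x \<in> carrier L \<Longrightarrow> x = (\<Otimes>i\<in>{..<n}. e i [^] coord x i)"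
  by (rule coord_inject) (auto simp: coord_combination basis_closed)

sublocale V: comm_group V
  unfolding complexification_def
  by (intro comm_group_tensor_group is_group comm_group.axioms(2) comm_group_complex_add)

sublocale T: comm_group T
  unfolding lattice_torus_def
  by (intro comm_group_tensor_group is_group comm_group.axioms(2) comm_group_complex_mult)

lemma group_complex_add: "group complex_add_group" and group_complex_mult: "group complex_mult_group"
  using comm_group_complex_add comm_group_complex_mult by (simp_all add: comm_group_def)

lemma vec_closed [simp]: "x \<in> carrier L \<Longrightarrow> x \<otimes>\<^sub>V z \<in> carrier V"
  by (simp add: complexification_def pure_tensor_closed)

lemma vec_hom_left: "(\<lambda>x. x \<otimes>\<^sub>V z) \<in> hom L V"
  unfolding complexification_def by (intro pure_tensor_hom_left is_group group_complex_add) simp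

lemma vec_hom_right: "x \<in> carrier L \<Longrightarrow> (\<lambda>z. x \<otimes>\<^sub>V z) \<in> hom complex_add_group V"
  unfolding complexification_def by (intro pure_tensor_hom_right is_group group_complex_add)

lemma vec_int_pow:
  assumes "x \<in> carrier L"
  shows "(x [^] (m::int)) \<otimes>\<^sub>V z = x \<otimes>\<^sub>V (of_int m * z)"
  using hom_int_pow[OF vec_hom_left assms is_group V.is_group, of m z]
    hom_int_pow[OF vec_hom_right[OF assms] _ group_complex_add V.is_group, of z m]
  by simp

lemma vec_hom_eqI:
  assumes "group K" "f \<in> hom V K" "g \<in> hom V K" "v \<in> carrier V"
    and "\<And>x z. x \<in> carrier L \<Longrightarrow> f (x \<otimes>\<^sub>V z) = g (x \<otimes>\<^sub>V z)"
  shows "f v = g v"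
  using is_group group_complex_add assms(4)[unfolded complexification_def]
proof (induction rule: tensor_group_induct)
  case (diff X Y)
  interpret f: group_hom V K f using assms by (simp add: group_hom_def group_hom_axioms_def)
  interpret g: group_hom V K g using assms by (simp add: group_hom_def group_hom_axioms_def)
  show ?case using diff by (simp flip: complexification_def)
qed (use assms(5) in simp)

lemma complex_coord_exists:
  "\<exists>h. h \<in> hom V complex_add_group \<and> (\<forall>x\<in>carrier L. \<forall>z. h (x \<otimes>\<^sub>V z) = of_int (coord x k) * z)"
proof -
  obtain h where "h \<in> hom V complex_add_group"
    "\<And>x z. x \<in> carrier L \<Longrightarrow> z \<in> carrier complex_add_group \<Longrightarrow> h (x \<otimes>\<^sub>V z) = of_int (coord x k) * z"
    unfolding complexification_def
    by (rule tensor_group_universal[OF is_group group_complex_add comm_group_complex_add,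
          where f = "\<lambda>x z. of_int (coord x k) * z"])
      (auto intro!: homI simp: coord_mult algebra_simps)
  then show ?thesis by auto
qed

text \<open>
  The \<open>k\<close>-th complex coordinate on \<open>V\<close>: the additive extension of
  \<open>x \<otimes> z \<mapsto> coord x k * z\<close>. Its values outside \<open>V\<close> are irrelevant.
\<close>

definition vcoord :: "nat \<Rightarrow> ('a \<times> complex \<Rightarrow>\<^sub>0 int) set \<Rightarrow> complex" where
  "vcoord k = (SOME h. h \<in> hom V complex_add_group \<and>
     (\<forall>x\<in>carrier L. \<forall>z. h (x \<otimes>\<^sub>V z) = of_int (coord x k) * z))"

lemma vcoord_hom: "vcoord k \<in> hom V complex_add_group"
  and vcoord_vec: "x \<in> carrier L \<Longrightarrow> vcoord k (x \<otimes>\<^sub>V z) = of_int (coord x k) * z"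
  using someI_ex[OF complex_coord_exists[of k]] unfolding vcoord_def by auto

text \<open>
  Both sides are additive in \<open>v\<close>, so it suffices to expand \<open>x\<close> in a pure tensor \<open>x \<otimes> z\<close>.
\<close>

lemma vec_expansion:
  assumes "v \<in> carrier V"
  shows "v = (\<Otimes>\<^bsub>V\<^esub>i\<in>{..<n}. e i \<otimes>\<^sub>V vcoord i v)"
proof (rule vec_hom_eqI[OF V.is_group _ _ assms])
  have vec_e: "(\<lambda>z. e i \<otimes>\<^sub>V z) \<in> hom complex_add_group V" if "i < n" for i
    using vec_hom_right basis_closed that by blast
  show "(\<lambda>v. v) \<in> hom V V" by (simp add: hom_def)
  show "(\<lambda>v. \<Otimes>\<^bsub>V\<^esub>i\<in>{..<n}. e i \<otimes>\<^sub>V vcoord i v) \<in> hom V V"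
  proof (rule homI)
    fix v w assume "v \<in> carrier V" "w \<in> carrier V"
    then have "(\<Otimes>\<^bsub>V\<^esub>i\<in>{..<n}. e i \<otimes>\<^sub>V vcoord i (v \<otimes>\<^bsub>V\<^esub> w)) =
        (\<Otimes>\<^bsub>V\<^esub>i\<in>{..<n}. e i \<otimes>\<^sub>V vcoord i v \<otimes>\<^bsub>V\<^esub> e i \<otimes>\<^sub>V vcoord i w)"
      using hom_mult[OF vcoord_hom] hom_mult[OF vec_e]
      by (intro V.finprod_cong) (auto simp: basis_closed simp_implies_def)
    then show "(\<Otimes>\<^bsub>V\<^esub>i\<in>{..<n}. e i \<otimes>\<^sub>V vcoord i (v \<otimes>\<^bsub>V\<^esub> w)) =
        (\<Otimes>\<^bsub>V\<^esub>i\<in>{..<n}. e i \<otimes>\<^sub>V vcoord i v) \<otimes>\<^bsub>V\<^esub> (\<Otimes>\<^bsub>V\<^esub>i\<in>{..<n}. e i \<otimes>\<^sub>V vcoord i w)"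
      by (simp add: basis_closed)
  qed (simp add: basis_closed)
  fix x z assume x: "x \<in> carrier L"
  have "x \<otimes>\<^sub>V z = (\<Otimes>i\<in>{..<n}. e i [^] coord x i) \<otimes>\<^sub>V z"
    using basis_expansion[OF x] by simp
  also have "\<dots> = (\<Otimes>\<^bsub>V\<^esub>i\<in>{..<n}. (e i [^] coord x i) \<otimes>\<^sub>V z)"
    using hom_finprod[OF comm_group_axioms V.comm_group_axioms vec_hom_left, of "{..<n}" "\<lambda>i. e i [^] coord x i" z]
    by (simp add: basis_closed o_def)
  also have "\<dots> = (\<Otimes>\<^bsub>V\<^esub>i\<in>{..<n}. e i \<otimes>\<^sub>V vcoord i (x \<otimes>\<^sub>V z))"
    by (intro V.finprod_cong) (auto simp: basis_closed vec_int_pow vcoord_vec x simp_implies_def)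
  finally show "x \<otimes>\<^sub>V z = (\<Otimes>\<^bsub>V\<^esub>i\<in>{..<n}. e i \<otimes>\<^sub>V vcoord i (x \<otimes>\<^sub>V z))" .
qed

lemma vcoord_inject:
  assumes "v \<in> carrier V" "w \<in> carrier V" "\<And>k. k < n \<Longrightarrow> vcoord k v = vcoord k w"
  shows "v = w"
proof -
  have "v = (\<Otimes>\<^bsub>V\<^esub>i\<in>{..<n}. e i \<otimes>\<^sub>V vcoord i v)" by (rule vec_expansion[OF assms(1)])
  also have "\<dots> = (\<Otimes>\<^bsub>V\<^esub>i\<in>{..<n}. e i \<otimes>\<^sub>V vcoord i w)"
    using assms by (intro V.finprod_cong) (auto simp: basis_closed simp_implies_def)
  also have "\<dots> = w" by (rule vec_expansion[OF assms(2), symmetric])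
  finally show ?thesis .
qed

lemma exp_hom: "(\<lambda>t. exp (2 * of_real pi * \<i> * t)) \<in> hom complex_add_group complex_mult_group"
  by (rule homI) (simp_all add: exp_add ring_distribs)

lemma lattice_exp_hom: "lattice_exp L \<in> hom V T"
  unfolding lattice_exp_def complexification_def lattice_torus_def
  by (intro tensor_map_hom is_group group_complex_add group_complex_mult exp_hom) (simp add: hom_def)

lemma lattice_exp_vec:
  "x \<in> carrier L \<Longrightarrow>
    lattice_exp L (x \<otimes>\<^sub>V z) = pure_tensor L complex_mult_group x (exp (2 * of_real pi * \<i> * z))"
  unfolding lattice_exp_def
  by (intro tensor_map_pure_tensor is_group group_complex_add group_complex_mult exp_hom) (simp_all add: hom_def)

text \<open>
  The coordinates of \<open>T\<close> extend \<open>x \<otimes> u \<mapsto> u powi coord x k\<close>; in coordinates, \<open>lattice_exp\<close> is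
  the exponential applied componentwise.
\<close>

lemma torus_coord_exists:
  obtains h where "h \<in> hom T complex_mult_group"
    "\<And>v. v \<in> carrier V \<Longrightarrow> h (lattice_exp L v) = exp (2 * of_real pi * \<i> * vcoord k v)"
proof -
  obtain h where h: "h \<in> hom T complex_mult_group"
    "\<And>x z. x \<in> carrier L \<Longrightarrow> z \<in> carrier complex_mult_group \<Longrightarrow>
      h (pure_tensor L complex_mult_group x z) = z powi coord x k"
    unfolding lattice_torus_def
    by (rule tensor_group_universal[OF is_group group_complex_mult comm_group_complex_mult,
          where f = "\<lambda>x z. z powi coord x k"])
      (auto intro!: homI simp: coord_mult power_int_add power_int_mult_distrib)
  have "(h \<circ> lattice_exp L) v = ((\<lambda>t. exp (2 * of_real pi * \<i> * t)) \<circ> vcoord k) v"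
    if "v \<in> carrier V" for v
  proof (rule vec_hom_eqI[OF group_complex_mult _ _ that])
    show "h \<circ> lattice_exp L \<in> hom V complex_mult_group"
      by (rule Group.hom_compose[OF lattice_exp_hom h(1)])
    show "(\<lambda>t. exp (2 * of_real pi * \<i> * t)) \<circ> vcoord k \<in> hom V complex_mult_group"
      by (rule Group.hom_compose[OF vcoord_hom exp_hom])
    fix x z assume "x \<in> carrier L"
    then show "(h \<circ> lattice_exp L) (x \<otimes>\<^sub>V z) = ((\<lambda>t. exp (2 * of_real pi * \<i> * t)) \<circ> vcoord k) (x \<otimes>\<^sub>V z)"
      by (simp add: lattice_exp_vec h(2) vcoord_vec exp_power_int mult_ac)
  qed
  then show thesis using h(1) that by auto
qed

text \<open>
  If \<open>v\<close> is in the kernel, then its coordinates are integers and hence those of an element of \<open>L\<close>.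
\<close>

lemma kernel_lattice_exp: "kernel V T (lattice_exp L) = (\<lambda>x. x \<otimes>\<^sub>V 1) ` carrier L"
proof (intro equalityI subsetI)
  fix v assume "v \<in> kernel V T (lattice_exp L)"
  then have v: "v \<in> carrier V" "lattice_exp L v = \<one>\<^bsub>T\<^esub>" by (simp_all add: kernel_def)
  have "\<exists>m::int. vcoord k v = of_int m" for k
  proof -
    obtain h where h: "h \<in> hom T complex_mult_group"
      "h (lattice_exp L v) = exp (2 * of_real pi * \<i> * vcoord k v)"
      using torus_coord_exists[of k] v(1) by metis
    then show ?thesis
      using hom_one[OF h(1) T.is_group group_complex_mult] v(2) by (simp flip: exp_2pi_i_eq_1_iff)
  qed
  then obtain m :: "nat \<Rightarrow> int" where m: "\<And>k. vcoord k v = of_int (m k)" by metis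
  let ?x = "\<Otimes>i\<in>{..<n}. e i [^] m i"
  have x: "?x \<in> carrier L" by (auto simp: basis_closed)
  have "v = ?x \<otimes>\<^sub>V 1"
    by (rule vcoord_inject) (simp_all add: v x vcoord_vec coord_combination m)
  then show "v \<in> (\<lambda>x. x \<otimes>\<^sub>V 1) ` carrier L" using x by blast
next
  fix v assume "v \<in> (\<lambda>x. x \<otimes>\<^sub>V 1) ` carrier L"
  then obtain x where x: "x \<in> carrier L" "v = x \<otimes>\<^sub>V 1" by blast
  have "lattice_exp L v = pure_tensor L complex_mult_group x \<one>\<^bsub>complex_mult_group\<^esub>"
    using x by (simp add: lattice_exp_vec)
  also have "\<dots> = \<one>\<^bsub>T\<^esub>"
    unfolding lattice_torus_def
    by (rule hom_one[OF pure_tensor_hom_right]) (use x is_group group_complex_mult T.is_group in \<open>simp_all add: lattice_torus_def\<close>)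
  finally show "v \<in> kernel V T (lattice_exp L)" using x by (simp add: kernel_def)
qed


section \<open>Lattice points in complexified subgroups\<close>

text \<open>
  The map \<open>N \<otimes> \<complex> \<rightarrow> L \<otimes> \<complex>\<close> induced by the inclusion of a subgroup \<open>N\<close> of \<open>L\<close>; its image is
  \<open>complexified_subgroup L N\<close>. The defining expression does not mention \<open>N\<close>.
\<close>

abbreviation "incl_tensor \<equiv> tensor_map L complex_add_group (\<lambda>x. x) (\<lambda>z. z)"

lemma incl_tensor_hom:
  assumes "subgroup N L"
  shows "incl_tensor \<in> hom (complexification (L\<lparr>carrier := N\<rparr>)) V"
proof -
  interpret N: subgroup N L by fact
  show ?thesis
    unfolding complexification_def
    by (intro tensor_map_hom subgroup_imp_group assms group_complex_add is_group) (auto simp: hom_def)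
qed

lemma incl_tensor_pure:
  assumes "subgroup N L" "x \<in> N"
  shows "incl_tensor (pure_tensor (L\<lparr>carrier := N\<rparr>) complex_add_group x z) = x \<otimes>\<^sub>V z"
proof -
  interpret N: subgroup N L by fact
  show ?thesis
    by (intro tensor_map_pure_tensor subgroup_imp_group assms group_complex_add is_group)
      (use assms in \<open>auto simp: hom_def\<close>)
qed

lemma complexification_subgroup_group:
  "subgroup N L \<Longrightarrow> comm_group (complexification (L\<lparr>carrier := N\<rparr>))"
  unfolding complexification_def
  by (intro comm_group_tensor_group subgroup_imp_group group_complex_add)

lemma incl_tensor_group_hom:
  "subgroup N L \<Longrightarrow> group_hom (complexification (L\<lparr>carrier := N\<rparr>)) V incl_tensor"
  by (intro group_hom.intro group_hom_axioms.intro incl_tensor_hom V.is_group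
      comm_group.axioms(2) complexification_subgroup_group)

lemma complexified_subgroup_subgroup:
  "subgroup N L \<Longrightarrow> subgroup (complexified_subgroup L N) V"
  unfolding complexified_subgroup_def by (rule group_hom.img_is_subgroup[OF incl_tensor_group_hom])

lemma vec_in_complexified:
  assumes "subgroup N L" "x \<in> N"
  shows "x \<otimes>\<^sub>V z \<in> complexified_subgroup L N"
proof -
  have "pure_tensor (L\<lparr>carrier := N\<rparr>) complex_add_group x z \<in> carrier (complexification (L\<lparr>carrier := N\<rparr>))"
    using assms by (simp add: complexification_def pure_tensor_closed)
  then show ?thesis
    unfolding complexified_subgroup_def using incl_tensor_pure[OF assms] by (metis image_eqI)
qed

lemma complexified_subgroup_induct [consumes 2, case_names pure diff]:
  assumes N: "subgroup N L" and v: "v \<in> complexified_subgroup L N"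
    and pure: "\<And>x z. x \<in> N \<Longrightarrow> P (x \<otimes>\<^sub>V z)"
    and diff: "\<And>v w. v \<in> complexified_subgroup L N \<Longrightarrow> w \<in> complexified_subgroup L N \<Longrightarrow>
      P v \<Longrightarrow> P w \<Longrightarrow> P (v \<otimes>\<^bsub>V\<^esub> inv\<^bsub>V\<^esub> w)"
  shows "P v"
proof -
  let ?N = "L\<lparr>carrier := N\<rparr>"
  interpret i: group_hom "complexification ?N" V incl_tensor
    by (rule incl_tensor_group_hom[OF N])
  obtain X where X: "X \<in> carrier (tensor_group ?N complex_add_group)" "v = incl_tensor X"
    using v by (auto simp: complexified_subgroup_def complexification_def)
  have "P (incl_tensor X)"
    using subgroup_imp_group[OF N] group_complex_add X(1)
  proof (induction rule: tensor_group_induct)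
    case (pure x z)
    then show ?case using incl_tensor_pure[OF N] assms(3) by simp
  next
    case (diff X Y)
    then show ?case
      using assms(4)[of "incl_tensor X" "incl_tensor Y"]
      by (simp add: complexified_subgroup_def flip: complexification_def)
  qed
  then show ?thesis using X by simp
qed

lemma complexified_subgroup_mono:
  assumes "subgroup N L" "subgroup M L" "N \<subseteq> M"
  shows "complexified_subgroup L N \<subseteq> complexified_subgroup L M"
proof
  interpret M: subgroup "complexified_subgroup L M" V
    by (rule complexified_subgroup_subgroup) fact
  fix v assume "v \<in> complexified_subgroup L N"
  with \<open>subgroup N L\<close> show "v \<in> complexified_subgroup L M"
    by (induction rule: complexified_subgroup_induct) (use assms in \<open>auto intro: vec_in_complexified\<close>)
qed

text \<open>
  Applying a \<open>\<rat>\<close>-valued additive map \<open>p\<close> to the coordinates sends the complex span of \<open>N\<close>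
  into its rational span, whose elements are written as \<open>a / k\<close> with \<open>a \<in> N\<close>.
\<close>

lemma rational_image_complexified:
  assumes N: "subgroup N L" and v: "v \<in> complexified_subgroup L N"
    and p_diff: "\<And>x y. p (x - y) = p x - (p y :: rat)"
    and p_scale: "\<And>m z. p (of_int m * z) = of_int m * p z"
  shows "\<exists>a\<in>N. \<exists>k::nat. k > 0 \<and> (\<forall>i. of_nat k * p (vcoord i v) = of_int (coord a i))"
  using N v
proof (induction rule: complexified_subgroup_induct)
  case (pure x z)
  interpret N: subgroup N L by fact
  obtain r s where rs: "quotient_of (p z) = (r, s)" by force
  then have s: "s > 0" "p z = of_int r / of_int s"
    using quotient_of_denom_pos quotient_of_div by auto
  \<comment> \<open>With \<open>p z = r / s\<close>, the image of \<open>x \<otimes> z\<close> is \<open>r x / s\<close>.\<close>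
  have "x [^] r \<in> N" using pure subgroup_int_pow_closed[OF N] by simp
  moreover have "of_nat (nat s) * p (vcoord i (x \<otimes>\<^sub>V z)) = of_int (coord (x [^] r) i)" for i
    using pure s by (simp add: vcoord_vec p_scale coord_int_pow)
  moreover have "nat s > 0" using s by simp
  ultimately show ?case by blast
next
  case (diff v w)
  interpret N: subgroup N L by fact
  interpret VN: subgroup "complexified_subgroup L N" V by (rule complexified_subgroup_subgroup[OF N])
  obtain a k b l where a: "a \<in> N" "(k::nat) > 0" "\<And>i. of_nat k * p (vcoord i v) = of_int (coord a i)"
    and b: "b \<in> N" "(l::nat) > 0" "\<And>i. of_nat l * p (vcoord i w) = of_int (coord b i)"
    using diff.IH by metis
  have vw: "vcoord i (v \<otimes>\<^bsub>V\<^esub> inv\<^bsub>V\<^esub> w) = vcoord i v - vcoord i w" for i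
  proof -
    interpret c: group_hom V complex_add_group "vcoord i"
      by (intro group_hom.intro group_hom_axioms.intro vcoord_hom V.is_group group_complex_add)
    show ?thesis using diff.hyps by simp
  qed
  have pow: "a [^] l \<in> N" "b [^] k \<in> N"
    using subgroup_int_pow_closed[OF N a(1), of "int l"] subgroup_int_pow_closed[OF N b(1), of "int k"]
    by (simp_all add: int_pow_int)
  have "a [^] l \<otimes> inv (b [^] k) \<in> N" using pow by simp
  moreover have "of_nat (k * l) * p (vcoord i (v \<otimes>\<^bsub>V\<^esub> inv\<^bsub>V\<^esub> w)) =
      of_int (coord (a [^] l \<otimes> inv (b [^] k)) i)" for i
  proof -
    have "of_int (coord (a [^] l \<otimes> inv (b [^] k)) i) =
        of_nat l * (of_int (coord a i) :: rat) - of_nat k * of_int (coord b i)"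
      using a b by (simp add: coord_mult coord_inv coord_nat_pow)
    also have "\<dots> = of_nat (k * l) * p (vcoord i (v \<otimes>\<^bsub>V\<^esub> inv\<^bsub>V\<^esub> w))"
      by (simp add: vw p_diff algebra_simps flip: a(3) b(3))
    finally show ?thesis ..
  qed
  ultimately show ?case using a(2) b(2) by (metis nat_0_less_mult_iff)
qed

text \<open>
  The lattice points in the complex span of \<open>N\<close> are the elements of \<open>L\<close> that are torsion modulo \<open>N\<close>.
  A retraction of \<open>\<complex>\<close> onto \<open>\<rat>\<close> leaves the coordinates of a lattice point unchanged, which
  reduces the forward direction to the rational span.
\<close>

lemma integral_in_complexified_iff:
  assumes N: "subgroup N L" and x: "x \<in> carrier L"
  shows "x \<otimes>\<^sub>V 1 \<in> complexified_subgroup L N \<longleftrightarrow> (\<exists>k::nat. k > 0 \<and> x [^] k \<in> N)"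
proof
  interpret N: subgroup N L by fact
  assume v: "x \<otimes>\<^sub>V 1 \<in> complexified_subgroup L N"
  obtain p :: "complex \<Rightarrow> rat" where p: "\<And>x y. p (x - y) = p x - p y"
    "\<And>m z. p (of_int m * z) = of_int m * p z" "p 1 = 1"
    using rational_functional by blast
  obtain a k where a: "a \<in> N" "(k::nat) > 0"
    "\<And>i. of_nat k * p (vcoord i (x \<otimes>\<^sub>V 1)) = of_int (coord a i)"
    using rational_image_complexified[OF N v p(1,2)] by metis
  have "x [^] k = a"
  proof (rule coord_inject)
    fix i
    have "(of_int (coord (x [^] k) i) :: rat) = of_int (coord a i)"
      using a(3)[of i] p(2)[of "coord x i" 1] x by (simp add: vcoord_vec p(3) coord_nat_pow)
    then show "coord (x [^] k) i = coord a i" by simp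
  qed (use a x in auto)
  then show "\<exists>k::nat. k > 0 \<and> x [^] k \<in> N" using a by blast
next
  assume "\<exists>k::nat. k > 0 \<and> x [^] k \<in> N"
  then obtain k :: nat where k: "k > 0" "x [^] k \<in> N" by blast
  have "(x [^] k) \<otimes>\<^sub>V (1 / of_nat k) = x \<otimes>\<^sub>V 1"
    using vec_int_pow[OF x, of "int k" "1 / of_nat k"] k by (simp add: int_pow_int)
  then show "x \<otimes>\<^sub>V 1 \<in> complexified_subgroup L N"
    using vec_in_complexified[OF N k(2), of "1 / of_nat k"] by simp
qed

lemma integral_in_sum_iff:
  assumes A: "subgroup A L" and B: "subgroup B L" and x: "x \<in> carrier L"
  shows "x \<otimes>\<^sub>V 1 \<in> complexified_subgroup L A <#>\<^bsub>V\<^esub> complexified_subgroup L B \<longleftrightarrow>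
    (\<exists>k::nat. k > 0 \<and> x [^] k \<in> A <#> B)"
proof
  interpret A: subgroup A L by fact
  interpret B: subgroup B L by fact
  have AB: "subgroup (A <#> B) L" by (rule mult_subgroups[OF A B])
  have "A \<subseteq> A <#> B"
  proof
    fix a assume "a \<in> A"
    then show "a \<in> A <#> B"
      unfolding set_mult_def using B.one_closed r_one[of a] A.mem_carrier[of a] by blast
  qed
  moreover have "B \<subseteq> A <#> B"
  proof
    fix b assume "b \<in> B"
    then show "b \<in> A <#> B"
      unfolding set_mult_def using A.one_closed l_one[of b] B.mem_carrier[of b] by blast
  qed
  ultimately have "complexified_subgroup L A <#>\<^bsub>V\<^esub> complexified_subgroup L B \<subseteq>
      complexified_subgroup L (A <#> B)"
    unfolding set_mult_def[of V]
    using complexified_subgroup_mono[OF A AB] complexified_subgroup_mono[OF B AB]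
      subgroup.m_closed[OF complexified_subgroup_subgroup[OF AB]]
    by blast
  moreover assume "x \<otimes>\<^sub>V 1 \<in> complexified_subgroup L A <#>\<^bsub>V\<^esub> complexified_subgroup L B"
  ultimately show "\<exists>k::nat. k > 0 \<and> x [^] k \<in> A <#> B"
    using integral_in_complexified_iff[OF AB x] by blast
next
  assume "\<exists>k::nat. k > 0 \<and> x [^] k \<in> A <#> B"
  then obtain k :: nat and a b where k: "k > 0" "a \<in> A" "b \<in> B" "x [^] k = a \<otimes> b"
    by (auto simp: set_mult_def)
  have ab: "a \<in> carrier L" "b \<in> carrier L"
    using k subgroup.mem_carrier A B by metis+
  have "x \<otimes>\<^sub>V 1 = (a \<otimes> b) \<otimes>\<^sub>V (1 / of_nat k)"
    using vec_int_pow[OF x, of "int k" "1 / of_nat k"] k by (simp add: int_pow_int)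
  also have "\<dots> = (a \<otimes>\<^sub>V (1 / of_nat k)) \<otimes>\<^bsub>V\<^esub> (b \<otimes>\<^sub>V (1 / of_nat k))"
    by (rule hom_mult[OF vec_hom_left ab])
  finally show "x \<otimes>\<^sub>V 1 \<in> complexified_subgroup L A <#>\<^bsub>V\<^esub> complexified_subgroup L B"
    using vec_in_complexified[OF A k(2)] vec_in_complexified[OF B k(3)]
    unfolding set_mult_def by blast
qed

end


section \<open>Torsion and intersections of subtori\<close>

theorem theorem1p1:
  fixes L :: "('a, 'm) monoid_scheme" and A B :: "'a set" and n :: nat
  assumes "comm_group L"
    and "L \<cong> free_Abelian_group {..<n}"
    and "primitive_sublattice A L"
    and "primitive_sublattice B L"
    and "complexified_subgroup L A \<inter> complexified_subgroup L B = {\<one>\<^bsub>complexification L\<^esub>}"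
  shows "(L Mod (A <#>\<^bsub>L\<^esub> B))\<lparr>carrier := torsion_subgroup (L Mod (A <#>\<^bsub>L\<^esub> B))\<rparr> \<cong>
         (lattice_torus L)\<lparr>carrier :=
            lattice_exp L ` complexified_subgroup L A \<inter>
            lattice_exp L ` complexified_subgroup L B\<rparr>"
proof -
  obtain e coord where "lattice_with_basis L n e coord"
    using lattice_with_basis_exists assms(1,2) by blast
  then interpret lattice_with_basis L n e coord .
  have A: "subgroup A L" and B: "subgroup B L"
    using assms(3,4) by (simp_all add: primitive_sublattice_def)
  have AB: "subgroup (A <#>\<^bsub>L\<^esub> B) L" by (rule mult_subgroups[OF A B])
  define W where "W = {x \<in> carrier L. \<exists>k::nat. k > 0 \<and> x [^]\<^bsub>L\<^esub> k \<in> A <#>\<^bsub>L\<^esub> B}"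
  have prim: "{x \<in> carrier L. x \<otimes>\<^sub>V 1 \<in> complexified_subgroup L N} = N"
    if N: "primitive_sublattice N L" for N
  proof -
    have sub: "subgroup N L" using N by (simp add: primitive_sublattice_def)
    have "x \<in> carrier L \<and> (\<exists>k::nat. k > 0 \<and> x [^]\<^bsub>L\<^esub> k \<in> N) \<longleftrightarrow> x \<in> N" for x
    proof
      assume "x \<in> N"
      moreover from this have "x \<in> carrier L" by (rule subgroup.mem_carrier[OF sub])
      ultimately show "x \<in> carrier L \<and> (\<exists>k::nat. k > 0 \<and> x [^]\<^bsub>L\<^esub> k \<in> N)"
        by (auto intro: exI[of _ 1])
    qed (use primitive_sublatticeD[OF assms(1) N] in blast)
    then show ?thesis using integral_in_complexified_iff[OF sub] by blast
  qed
  have sum: "{x \<in> carrier L. x \<otimes>\<^sub>V 1 \<in> complexified_subgroup L A <#>\<^bsub>V\<^esub> complexified_subgroup L B} = W"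
    using integral_in_sum_iff[OF A B] by (auto simp: W_def)
  have "L\<lparr>carrier := W\<rparr> Mod (A <#>\<^bsub>L\<^esub> B) \<cong>
      T\<lparr>carrier := lattice_exp L ` complexified_subgroup L A \<inter> lattice_exp L ` complexified_subgroup L B\<rparr>"
    using Mod_connecting_iso[OF assms(1) V.comm_group_axioms T.comm_group_axioms vec_hom_left lattice_exp_hom
        kernel_lattice_exp complexified_subgroup_subgroup[OF A] complexified_subgroup_subgroup[OF B] assms(5)]
    by (simp only: prim[OF assms(3)] prim[OF assms(4)] sum)
  \<comment> \<open>Cosets and their products do not depend on the ambient carrier, so that \<open>W / (A + B)\<close> is
    literally the torsion subgroup of \<open>L / (A + B)\<close>.\<close>
  moreover have "L\<lparr>carrier := W\<rparr> Mod (A <#>\<^bsub>L\<^esub> B) =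
      (L Mod (A <#>\<^bsub>L\<^esub> B))\<lparr>carrier := torsion_subgroup (L Mod (A <#>\<^bsub>L\<^esub> B))\<rparr>"
    unfolding torsion_subgroup_Mod[OF assms(1) AB] W_def[symmetric]
    by (auto simp: FactGroup_def RCOSETS_def r_coset_def set_mult_def fun_eq_iff)
  ultimately show ?thesis by simp
qed

end
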